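(* Let $K$ be a finite simplicial complex, let $\overrightarrow{W}$ be a Morse sequence on $K$, and let $\Upsilon$ be the Morse reference of $\overrightarrow{W}$ and $\Upsilon^*$ its Morse co-reference. Let $\sigma\in K^{(p)}$ and $\tau\in K^{(p+1)}$ be both critical for $\overrightarrow{W}$. Then $\sigma\in\Upsilon(\partial(\tau))$ if and only if $\tau\in\Upsilon^*(\delta(\sigma))$.
   Context: A finite simplicial complex $K$ is a finite family of non-empty finite sets such that $\sigma\in K$ whenever $\emptyset\neq\sigma\subseteq\tau$ for some $\tau\in K$; $K^{(p)}$ is the set of $p$-simplexes (sets of $p+1$ elements), and a facet is an inclusion-maximal simplex. For $p\ge -1$, $K[p]$ is the set of all subsets of $K^{(p)}$ (with $K^{(-1)}=\emptyset$), a $\mathbb{Z}_2$-vector space under symmetric difference, the empty chain being $0$. For $\sigma\in K^{(p)}$, $\partial(\sigma)=\{\tau\in K^{(p-1)}:\tau\subset\sigma\}$ and $\delta(\sigma)=\{\tau\in K^{(p+1)}:\sigma\subset\tau\}$. A pair $(\sigma,\tau)$ with $\sigma\in K^{(p)},\tau\in K^{(p+1)}$ is free for $K$ if $\tau$ is the only simplex of $K$ strictly containing $\sigma$; then $K$ is an elementary expansion of $K\setminus\{\sigma,\tau\}$. If $\sigma$ is a facet of $K$, $K$ is an elementary filling of $K\setminus\{\sigma\}$. A Morse sequence on $K$ is a sequence $\langle\emptyset=K_0,\dots,K_k=K\rangle$ where each $K_i$ is an elementary expansion or elementary filling of $K_{i-1}$; a simplex added by a filling is critical, and a free pair $(\sigma,\tau)$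 added by an expansion is a regular pair. $\ddot{W}[p]$ denotes the set of subsets of the set of critical $p$-simplexes. A Morse frame is a map $\Upsilon$ sending each $\sigma\in K^{(p)}$ to $\Upsilon(\sigma)\in\ddot{W}[p]$, extended to chains by $\Upsilon(c)=\sum_{\sigma\in c}\Upsilon(\sigma)$ (mod 2), $\Upsilon(\emptyset)=0$. The Morse reference $\Upsilon$ is the unique frame with $\Upsilon(\sigma)=\{\sigma\}$ for critical $\sigma$ and, for each regular pair $(\sigma,\tau)$, $\Upsilon(\tau)=0$ and $\Upsilon(\sigma)=\Upsilon(\partial(\tau)\setminus\{\sigma\})$. The Morse co-reference $\Upsilon^*$ is the unique frame with $\Upsilon^*(\sigma)=\{\sigma\}$ for critical $\sigma$ and, for each regular pair $(\sigma,\tau)$, $\Upsilon^*(\sigma)=0$ and $\Upsilon^*(\tau)=\Upsilon^*(\delta(\sigma)\setminus\{\tau\})$. *)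

theory Defs
  imports Main "HOL-Library.FuncSet"
begin

definition simplicial_complex :: "'a set set \<Rightarrow> bool" where
  "simplicial_complex K \<longleftrightarrow>
     finite K \<and> (\<forall>\<tau>\<in>K. finite \<tau> \<and> \<tau> \<noteq> {}) \<and>
     (\<forall>\<tau>\<in>K. \<forall>\<sigma>. \<sigma> \<noteq> {} \<and> \<sigma> \<subseteq> \<tau> \<longrightarrow> \<sigma> \<in> K)"

text \<open>Dimensions are integers, so that the set of (-1)-simplexes of a complex makes sense;
  it is empty because the empty set is not a simplex.\<close>

definition sdim :: "'a set \<Rightarrow> int" where
  "sdim \<sigma> = int (card \<sigma>) - 1"

definition simplexes :: "'a set set \<Rightarrow> int \<Rightarrow> 'a set set" where
  "simplexes K p = {\<sigma>\<in>K. sdim \<sigma> = p}"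

definition facet :: "'a set set \<Rightarrow> 'a set \<Rightarrow> bool" where
  "facet K \<sigma> \<longleftrightarrow> \<sigma> \<in> K \<and> (\<forall>\<tau>\<in>K. \<sigma> \<subseteq> \<tau> \<longrightarrow> \<tau> = \<sigma>)"

definition boundary :: "'a set set \<Rightarrow> 'a set \<Rightarrow> 'a set set" where
  "boundary K \<sigma> = {\<tau> \<in> simplexes K (sdim \<sigma> - 1). \<tau> \<subset> \<sigma>}"

definition coboundary :: "'a set set \<Rightarrow> 'a set \<Rightarrow> 'a set set" where
  "coboundary K \<sigma> = {\<tau> \<in> simplexes K (sdim \<sigma> + 1). \<sigma> \<subset> \<tau>}"

text \<open>Chains over the two-element field are sets of simplexes, added by symmetric difference.
  \<open>chain_sum f c\<close> is the sum of \<open>f \<sigma>\<close> over the (finite) index set \<open>c\<close>;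
  with \<open>f\<close> a frame it is the linear extension of \<open>f\<close> evaluated at the chain \<open>c\<close>.\<close>

global_interpretation chain_sum: comm_monoid_set "\<lambda>A B :: 'b set. sym_diff A B" "{}"
  defines chain_sum = chain_sum.F
  by standard auto

definition free_pair :: "'a set set \<Rightarrow> 'a set \<Rightarrow> 'a set \<Rightarrow> bool" where
  "free_pair K \<sigma> \<tau> \<longleftrightarrow>
     (\<exists>p. \<sigma> \<in> simplexes K p \<and> \<tau> \<in> simplexes K (p + 1)) \<and> {\<nu>\<in>K. \<sigma> \<subset> \<nu>} = {\<tau>}"

text \<open>\<open>expansion_by L K \<sigma> \<tau>\<close> and \<open>filling_by L K \<sigma>\<close>: the complex \<open>K\<close> is an elementary
  expansion (filling) of \<open>L\<close>, the added simplexes being \<open>\<sigma>\<close> and \<open>\<tau>\<close> (\<open>\<sigma>\<close>, respectively).\<close>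

definition expansion_by :: "'a set set \<Rightarrow> 'a set set \<Rightarrow> 'a set \<Rightarrow> 'a set \<Rightarrow> bool" where
  "expansion_by L K \<sigma> \<tau> \<longleftrightarrow> free_pair K \<sigma> \<tau> \<and> L = K - {\<sigma>, \<tau>}"

definition filling_by :: "'a set set \<Rightarrow> 'a set set \<Rightarrow> 'a set \<Rightarrow> bool" where
  "filling_by L K \<sigma> \<longleftrightarrow> facet K \<sigma> \<and> L = K - {\<sigma>}"

text \<open>Storing only the complexes loses no information: a filling adds one simplex and an
  expansion two of different dimensions, so the kind of each step and the simplexes it adds
  are determined by two consecutive complexes.\<close>

definition morse_sequence :: "'a set set \<Rightarrow> 'a set set list \<Rightarrow> bool" where
  "morse_sequence K W \<longleftrightarrow>
     W \<noteq> [] \<and> hd W = {} \<and> last W = K \<and> (\<forall>L\<in>set W. simplicial_complex L) \<and>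
     (\<forall>i. Suc i < length W \<longrightarrow>
        (\<exists>\<sigma> \<tau>. expansion_by (W ! i) (W ! Suc i) \<sigma> \<tau>) \<or>
        (\<exists>\<sigma>. filling_by (W ! i) (W ! Suc i) \<sigma>))"

definition critical :: "'a set set list \<Rightarrow> 'a set \<Rightarrow> bool" where
  "critical W \<sigma> \<longleftrightarrow> (\<exists>i. Suc i < length W \<and> filling_by (W ! i) (W ! Suc i) \<sigma>)"

definition regular_pair :: "'a set set list \<Rightarrow> 'a set \<Rightarrow> 'a set \<Rightarrow> bool" where
  "regular_pair W \<sigma> \<tau> \<longleftrightarrow> (\<exists>i. Suc i < length W \<and> expansion_by (W ! i) (W ! Suc i) \<sigma> \<tau>)"

definition critical_chains :: "'a set set list \<Rightarrow> int \<Rightarrow> 'a set set set" where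
  "critical_chains W p = Pow {\<sigma>. critical W \<sigma> \<and> sdim \<sigma> = p}"

text \<open>Frames are maps with domain \<open>K\<close>; using extensional functions makes the unique frames
  below unique as HOL functions.\<close>

definition morse_frames :: "'a set set \<Rightarrow> 'a set set list \<Rightarrow> ('a set \<Rightarrow> 'a set set) set" where
  "morse_frames K W = (\<Pi>\<^sub>E \<sigma>\<in>K. critical_chains W (sdim \<sigma>))"

definition is_morse_reference ::
    "'a set set \<Rightarrow> 'a set set list \<Rightarrow> ('a set \<Rightarrow> 'a set set) \<Rightarrow> bool" where
  "is_morse_reference K W \<Upsilon> \<longleftrightarrow>
     \<Upsilon> \<in> morse_frames K W \<and>
     (\<forall>\<sigma>. critical W \<sigma> \<longrightarrow> \<Upsilon> \<sigma> = {\<sigma>}) \<and>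
     (\<forall>\<sigma> \<tau>. regular_pair W \<sigma> \<tau> \<longrightarrow>
        \<Upsilon> \<tau> = {} \<and> \<Upsilon> \<sigma> = chain_sum \<Upsilon> (boundary K \<tau> - {\<sigma>}))"

definition is_morse_coreference ::
    "'a set set \<Rightarrow> 'a set set list \<Rightarrow> ('a set \<Rightarrow> 'a set set) \<Rightarrow> bool" where
  "is_morse_coreference K W \<Upsilon> \<longleftrightarrow>
     \<Upsilon> \<in> morse_frames K W \<and>
     (\<forall>\<sigma>. critical W \<sigma> \<longrightarrow> \<Upsilon> \<sigma> = {\<sigma>}) \<and>
     (\<forall>\<sigma> \<tau>. regular_pair W \<sigma> \<tau> \<longrightarrow>
        \<Upsilon> \<sigma> = {} \<and> \<Upsilon> \<tau> = chain_sum \<Upsilon> (coboundary K \<sigma> - {\<tau>}))"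

definition morse_reference :: "'a set set \<Rightarrow> 'a set set list \<Rightarrow> 'a set \<Rightarrow> 'a set set" where
  "morse_reference K W = (THE \<Upsilon>. is_morse_reference K W \<Upsilon>)"

definition morse_coreference :: "'a set set \<Rightarrow> 'a set set list \<Rightarrow> 'a set \<Rightarrow> 'a set set" where
  "morse_coreference K W = (THE \<Upsilon>. is_morse_coreference K W \<Upsilon>)"

end

theory Submission
  imports Defs
begin

text \<open>
  Let \<open>A\<close> be the set of \<open>p\<close>-simplexes \<open>\<nu>\<close> with \<open>\<sigma> \<in> \<Upsilon>(\<nu>)\<close> and \<open>B\<close> the set of
  \<open>(p + 1)\<close>-simplexes \<open>\<omega>\<close> with \<open>\<tau> \<in> \<Upsilon>\<^sup>*(\<omega>)\<close>. Count modulo 2 the pairs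
  \<open>(\<nu>, \<omega>) \<in> A \<times> B\<close> with \<open>\<nu> \<subset> \<omega>\<close>. An element of \<open>B\<close> other than \<open>\<tau>\<close> is the upper simplex of
  a regular pair, so that \<open>\<Upsilon>(\<partial>(\<omega>)) = 0\<close> and it has an even number of faces in \<open>A\<close>; hence the
  number of pairs is odd iff \<open>\<sigma> \<in> \<Upsilon>(\<partial>(\<tau>))\<close>. Dually, it is odd iff \<open>\<tau> \<in> \<Upsilon>\<^sup>*(\<delta>(\<sigma>))\<close>.
\<close>

section \<open>Sums of chains\<close>

text \<open>Membership of \<open>s\<close> is a linear functional over Z_2: each summand containing
  \<open>s\<close> flips it. Chain identities thus become parity statements.\<close>

lemma mem_chain_sum_iff:
  assumes "finite c"
  shows "s \<in> chain_sum f c \<longleftrightarrow> odd (card {x \<in> c. s \<in> f x})"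
  using assms
proof (induction c rule: finite_induct)
  case empty
  then show ?case by simp
next
  case (insert x c)
  have "{y \<in> insert x c. s \<in> f y} =
      (if s \<in> f x then insert x {y \<in> c. s \<in> f y} else {y \<in> c. s \<in> f y})"
    by auto
  with insert show ?case by auto
qed

lemma chain_sum_subset: "(\<And>x. x \<in> c \<Longrightarrow> f x \<subseteq> S) \<Longrightarrow> chain_sum f c \<subseteq> S"
proof (induction c rule: infinite_finite_induct)
  case (insert x c)
  then have "f x \<subseteq> S" "chain_sum f c \<subseteq> S" by auto
  with insert.hyps show ?case by auto
qed auto

text \<open>Over Z_2 the sum is \<open>f x\<close> added to itself. This turns the recursive
  equation of a frame at a regular pair into vanishing on a whole boundary or coboundary.\<close>

lemma chain_sum_eq_empty:
  assumes "finite c" "x \<in> c" "f x = chain_sum f (c - {x})"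
  shows "chain_sum f c = {}"
  using chain_sum.remove[OF assms(1,2), of f] assms(3) by simp

text \<open>Double counting: both sides are the parity of the number of pairs related by
  \<open>R\<close>, since a sum is odd iff an odd number of its terms are.\<close>

lemma odd_card_odd_swap:
  assumes "finite A" "finite B"
  shows "odd (card {b \<in> B. odd (card {a \<in> A. R a b})}) \<longleftrightarrow>
         odd (card {a \<in> A. odd (card {b \<in> B. R a b})})"
proof -
  have "(\<Sum>b\<in>B. card {a \<in> A. R a b}) = (\<Sum>a\<in>A. card {b \<in> B. R a b})"
    using assms sum.swap_restrict[of B A "\<lambda>_ _. 1::nat" "\<lambda>b a. R a b"] by simp
  then show ?thesis
    using even_sum_iff[of B "\<lambda>b. card {a \<in> A. R a b}"]
      even_sum_iff[of A "\<lambda>a. card {b \<in> B. R a b}"] assms by simp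
qed

section \<open>Frames defined by well-founded recursion\<close>

text \<open>With \<open>Q\<close> the relation of regular pairs and \<open>B\<close> the boundary this yields the reference; with
  the converse relation and the coboundary, the co-reference.\<close>

lemma ex1_frame:
  fixes C :: "'a set \<Rightarrow> bool" and Q :: "'a set \<Rightarrow> 'a set \<Rightarrow> bool"
    and B :: "'a set \<Rightarrow> 'a set set" and r :: "('a set \<times> 'a set) set"
  assumes wf: "wf r"
    and cover: "\<And>x. x \<in> K \<longleftrightarrow> C x \<or> (\<exists>y. Q x y) \<or> (\<exists>y. Q y x)"
    and excl: "\<And>x y. C x \<Longrightarrow> \<not> Q x y" "\<And>x y. C x \<Longrightarrow> \<not> Q y x" "\<And>x y z. Q x y \<Longrightarrow> \<not> Q z x"
    and functional: "\<And>x y z. Q x y \<Longrightarrow> Q x z \<Longrightarrow> y = z"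
    and dep: "\<And>x y z. Q x y \<Longrightarrow> z \<in> B y - {x} \<Longrightarrow> z \<in> K \<and> (z, x) \<in> r \<and> sdim z = sdim x"
  shows "\<exists>!f. f \<in> (\<Pi>\<^sub>E x\<in>K. Pow {c. C c \<and> sdim c = sdim x}) \<and> (\<forall>x. C x \<longrightarrow> f x = {x}) \<and>
    (\<forall>x y. Q x y \<longrightarrow> f y = {} \<and> f x = chain_sum f (B y - {x}))"
    (is "\<exists>!f. ?P f")
proof -
  \<comment> \<open>An element of \<open>K\<close> failing the first two tests is, by
    \<open>cover\<close>, the second component of a pair. The value \<open>undefined\<close> outside
    \<open>K\<close> makes the fixed point extensional.\<close>
  define F where "F f x = (if C x then {x} else if \<exists>y. Q x y then
      chain_sum f (B (THE y. Q x y) - {x}) else if x \<in> K then {} else undefined)"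
    for f :: "'a set \<Rightarrow> 'a set set" and x
  have the_eq: "(THE y. Q x y) = y" if "Q x y" for x y
    using that by (rule the_equality) (rule functional[OF _ that])
  have "adm_wf r F"
    unfolding adm_wf_def
  proof (intro allI impI)
    fix f g :: "'a set \<Rightarrow> 'a set set" and x
    assume fg: "\<forall>z. (z, x) \<in> r \<longrightarrow> f z = g z"
    \<comment> \<open>By \<open>dep\<close>, the recursive call reaches only elements
      \<open>r\<close>-below \<open>x\<close>.\<close>
    have "chain_sum f (B y - {x}) = chain_sum g (B y - {x})" if "Q x y" for y
      using dep[OF that] fg by (intro chain_sum.cong) auto
    then show "F f x = F g x"
      by (auto simp: F_def the_eq)
  qed
  then have "wfrec r F = F (wfrec r F)"
    by (rule wfrec_fixpoint[OF wf])
  then obtain f where f_eq: "\<And>x. f x = F f x"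
    by metis
  have f_crit: "f x = {x}" if "C x" for x
    using that f_eq[of x] by (simp add: F_def)
  have f_out: "f x = undefined" if "x \<notin> K" for x
  proof -
    have "\<not> C x" "\<nexists>y. Q x y"
      using that cover by blast+
    with that show ?thesis using f_eq[of x] by (auto simp: F_def)
  qed
  have f_snd: "f y = {}" if "Q x y" for x y
  proof -
    have "\<not> C y" "\<nexists>z. Q y z" "y \<in> K"
      using that excl cover by blast+
    then show ?thesis using f_eq[of y] by (auto simp: F_def)
  qed
  have f_fst: "f x = chain_sum f (B y - {x})" if "Q x y" for x y
  proof -
    have "\<not> C x" "\<exists>y. Q x y"
      using that excl(1) by blast+
    then show ?thesis using f_eq[of x] the_eq[OF that] by (auto simp: F_def)
  qed
  have f_range: "f x \<subseteq> {c. C c \<and> sdim c = sdim x}" if "x \<in> K" for x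
    using wf that
  proof (induction x rule: wf_induct_rule)
    case (less x)
    consider "C x" | y where "Q x y" | y where "Q y x"
      using less.prems cover by blast
    then show ?case
    proof cases
      case (2 y)
      \<comment> \<open>Dimension is constant along the recursion, so the bound for \<open>z\<close>
        is also the one for \<open>x\<close>.\<close>
      have "f z \<subseteq> {c. C c \<and> sdim c = sdim x}" if "z \<in> B y - {x}" for z
        using less.IH[of z] dep[OF 2 that] by simp
      then show ?thesis
        unfolding f_fst[OF 2] by (rule chain_sum_subset)
    qed (auto simp: f_crit f_snd)
  qed
  show ?thesis
  proof (rule ex1I)
    show "?P f"
      using f_crit f_out f_snd f_fst f_range by (auto simp: PiE_def extensional_def Pi_def)
  next
    fix g assume g: "?P g"
    show "g = f"
    proof
      fix x show "g x = f x"
        using wf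
      proof (induction x rule: wf_induct_rule)
        case (less x)
        consider "C x" | y where "Q x y" | y where "Q y x" | "x \<notin> K"
          using cover by blast
        then show ?case
        proof cases
          case (2 y)
          have "chain_sum g (B y - {x}) = chain_sum f (B y - {x})"
            using less.IH dep[OF 2] by (intro chain_sum.cong) auto
          then show ?thesis
            using f_fst[OF 2] g 2 by simp
        next
          case 4
          then show ?thesis using f_out g by (auto simp: PiE_def extensional_def)
        qed (use g f_crit f_snd in auto)
      qed
    qed
  qed
qed

section \<open>Existence of the reference and the co-reference\<close>

lemma filling_by_new: "filling_by L M \<sigma> \<Longrightarrow> L \<subseteq> M \<and> M - L = {\<sigma>}"
  unfolding filling_by_def facet_def by auto

lemma expansion_by_new:
  assumes "expansion_by L M \<sigma> \<tau>"
  shows "L \<subseteq> M" "M - L = {\<sigma>, \<tau>}" "\<sigma> \<subset> \<tau>" "sdim \<tau> = sdim \<sigma> + 1"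
    "\<nu> \<in> M \<Longrightarrow> \<sigma> \<subset> \<nu> \<Longrightarrow> \<nu> = \<tau>"
  using assms unfolding expansion_by_def free_pair_def simplexes_def by blast+

section \<open>The filtration given by a Morse sequence\<close>

context
  fixes K :: "'a set set" and W :: "'a set set list"
  assumes morse: "morse_sequence K W"
begin

lemma morse_sequence_step:
  assumes "Suc i < length W"
  obtains \<sigma> \<tau> where "expansion_by (W ! i) (W ! Suc i) \<sigma> \<tau>"
  | \<sigma> where "filling_by (W ! i) (W ! Suc i) \<sigma>"
  using morse assms unfolding morse_sequence_def by blast

lemma morse_sequence_mono: "i \<le> j \<Longrightarrow> j < length W \<Longrightarrow> W ! i \<subseteq> W ! j"
proof (induction j rule: dec_induct)
  case (step j)
  then have "W ! j \<subseteq> W ! Suc j"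
    by (metis morse_sequence_step expansion_by_new(1) filling_by_new)
  with step show ?case by auto
qed simp

lemma morse_sequence_subset: "i < length W \<Longrightarrow> W ! i \<subseteq> K"
  using morse_sequence_mono[of i "length W - 1"] morse last_conv_nth[of W]
  unfolding morse_sequence_def by fastforce

text \<open>Since the complexes of \<open>W\<close> increase, for a simplex of \<open>K\<close> this
  is the step that adds it. It orders both recursions.\<close>

definition rank :: "'a set \<Rightarrow> nat" where
  "rank x = (LEAST i. x \<in> W ! i)"

lemma rank_eq:
  assumes "Suc i < length W" "x \<in> W ! Suc i - W ! i"
  shows "rank x = Suc i"
  unfolding rank_def
proof (rule Least_equality)
  \<comment> \<open>Only indices up to \<open>i\<close> could violate the bound, so the unspecified
    values of \<open>W ! j\<close> past the end do no harm.\<close>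
  fix j assume "x \<in> W ! j"
  then show "Suc i \<le> j"
    using morse_sequence_mono[of j i] assms by (force simp: not_less_eq_eq)
qed (use assms in simp)

lemma rank_le: "x \<in> W ! i \<Longrightarrow> rank x \<le> i"
  unfolding rank_def by (rule Least_le)

lemma rank_of_mem:
  assumes "x \<in> K"
  obtains i where "rank x = Suc i" "Suc i < length W" "x \<in> W ! Suc i - W ! i"
proof -
  have W: "W \<noteq> []" "W ! 0 = {}" "W ! (length W - 1) = K"
    using morse by (auto simp: morse_sequence_def hd_conv_nth last_conv_nth)
  then have x: "x \<in> W ! rank x" "rank x \<le> length W - 1"
    unfolding rank_def using assms by (metis LeastI, metis Least_le)
  then obtain i where i: "rank x = Suc i"
    using W(2) by (cases "rank x") auto
  then have "x \<notin> W ! i"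
    using rank_le[of x i] by auto
  then show ?thesis
    using that[of i] x i W(1) by (cases W) auto
qed

lemma criticalD:
  assumes "critical W x"
  shows "x \<in> K" "W ! rank x - W ! (rank x - 1) = {x}"
proof -
  obtain i where i: "Suc i < length W" "filling_by (W ! i) (W ! Suc i) x"
    using assms unfolding critical_def by blast
  with filling_by_new have new: "W ! Suc i - W ! i = {x}" by blast
  then have "rank x = Suc i"
    using i by (intro rank_eq) auto
  with new i(1) morse_sequence_subset[of "Suc i"]
  show "x \<in> K" "W ! rank x - W ! (rank x - 1) = {x}" by auto
qed

text \<open>The last two claims express the acyclicity of a Morse sequence; they make the recursions
  for the reference and the co-reference descend.\<close>

lemma regular_pairD:
  assumes "regular_pair W x y"
  shows "x \<in> K" "y \<in> K" "x \<subset> y" "sdim y = sdim x + 1" "rank x = rank y"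
    "W ! rank x - W ! (rank x - 1) = {x, y}"
    "z \<in> boundary K y - {x} \<Longrightarrow> rank z < rank x"
    "z \<in> coboundary K x - {y} \<Longrightarrow> rank y < rank z"
proof -
  obtain i where i: "Suc i < length W" "expansion_by (W ! i) (W ! Suc i) x y"
    using assms unfolding regular_pair_def by blast
  note new = expansion_by_new[OF i(2)]
  have rk: "rank x = Suc i" "rank y = Suc i"
    using i new by (auto intro!: rank_eq)
  show xy: "x \<in> K" "y \<in> K" "x \<subset> y" "sdim y = sdim x + 1" "rank x = rank y"
    "W ! rank x - W ! (rank x - 1) = {x, y}"
    using rk new i(1) morse_sequence_subset[of "Suc i"] by auto
  show "rank z < rank x" if z: "z \<in> boundary K y - {x}"
  proof -
    have "simplicial_complex (W ! Suc i)" "simplicial_complex K"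
      using morse i(1) unfolding morse_sequence_def by (auto dest: last_in_set)
    moreover have "z \<in> K" "z \<subset> y" "z \<noteq> x" "y \<in> W ! Suc i"
      using z new(2) by (auto simp: boundary_def simplexes_def)
    \<comment> \<open>The complex reached by the expansion is closed under faces and the step adds
      only \<open>x\<close> and \<open>y\<close>, so \<open>z\<close> was there before.\<close>
    ultimately have "z \<in> W ! Suc i"
      unfolding simplicial_complex_def by (metis psubset_imp_subset)
    with new(2) \<open>z \<subset> y\<close> \<open>z \<noteq> x\<close> have "z \<in> W ! i" by auto
    then show ?thesis using rank_le rk by fastforce
  qed
  show "rank y < rank z" if z: "z \<in> coboundary K x - {y}"
  proof -
    \<comment> \<open>Freeness: in that complex only \<open>y\<close> strictly contains
      \<open>x\<close>, so any other coface is added later.\<close>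
    have "z \<notin> W ! Suc i"
      using z new(5)[of z] unfolding coboundary_def by auto
    moreover obtain j where "rank z = Suc j" "Suc j < length W" "z \<in> W ! Suc j"
      using z rank_of_mem[of z] unfolding coboundary_def simplexes_def by blast
    ultimately show ?thesis
      using rk i(1) morse_sequence_mono[of "Suc j" "Suc i"] by (force simp: not_less)
  qed
qed

section \<open>Partition of the complex into critical simplexes and regular pairs\<close>

lemma mem_cases:
  "x \<in> K \<longleftrightarrow> critical W x \<or> (\<exists>y. regular_pair W x y) \<or> (\<exists>y. regular_pair W y x)"
proof
  assume "x \<in> K"
  then obtain i where i: "Suc i < length W" "x \<in> W ! Suc i - W ! i"
    using rank_of_mem by blast
  from i(1) show "critical W x \<or> (\<exists>y. regular_pair W x y) \<or> (\<exists>y. regular_pair W y x)"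
  proof (cases rule: morse_sequence_step)
    case (1 \<sigma> \<tau>)
    then have "x = \<sigma> \<or> x = \<tau>" using expansion_by_new(2)[OF 1] i by blast
    then show ?thesis using 1 i unfolding regular_pair_def by blast
  next
    case (2 \<sigma>)
    then have "x = \<sigma>" using filling_by_new[OF 2] i by blast
    then show ?thesis using 2 i unfolding critical_def by blast
  qed
qed (use criticalD regular_pairD in blast)

text \<open>The step that adds \<open>x\<close> adds nothing else, whereas an expansion adds two
  distinct simplexes.\<close>

lemma critical_not_regular:
  assumes "critical W x"
  shows "\<not> regular_pair W x y" "\<not> regular_pair W y x"
proof -
  have False if "regular_pair W u v" "x = u \<or> x = v" for u v
  proof -
    have "{u, v} = {x}"
      using criticalD[OF assms] regular_pairD(5,6)[OF that(1)] that(2) by auto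
    then show False using regular_pairD(3)[OF that(1)] by auto
  qed
  then show "\<not> regular_pair W x y" "\<not> regular_pair W y x" by blast+
qed

text \<open>A shared member gives both pairs the same rank, hence the same two added simplexes;
  strict inclusion fixes their order.\<close>

lemma regular_pair_unique:
  assumes "regular_pair W x y" "regular_pair W u v" "{x, y} \<inter> {u, v} \<noteq> {}"
  shows "x = u" "y = v"
proof -
  have "rank x = rank u"
    using assms(3) regular_pairD(5)[OF assms(1)] regular_pairD(5)[OF assms(2)] by auto
  then have "{x, y} = {u, v}"
    using regular_pairD(6)[OF assms(1)] regular_pairD(6)[OF assms(2)] by simp
  then show "x = u" "y = v"
    using regular_pairD(3)[OF assms(1)] regular_pairD(3)[OF assms(2)]
    by (auto simp: doubleton_eq_iff)
qed

lemma is_morse_reference: "is_morse_reference K W (morse_reference K W)"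
proof -
  have "\<exists>!f. f \<in> (\<Pi>\<^sub>E x\<in>K. Pow {c. critical W c \<and> sdim c = sdim x}) \<and>
      (\<forall>x. critical W x \<longrightarrow> f x = {x}) \<and>
      (\<forall>x y. regular_pair W x y \<longrightarrow> f y = {} \<and> f x = chain_sum f (boundary K y - {x}))"
  proof (rule ex1_frame[OF wf_measure[of rank]])
    show "\<not> regular_pair W z x" if "regular_pair W x y" for x y z
      using regular_pair_unique(1)[OF that, of z x] regular_pairD(3)[of z x] by blast
    show "y = z" if "regular_pair W x y" "regular_pair W x z" for x y z
      using regular_pair_unique(2)[OF that] by blast
    show "z \<in> K \<and> (z, x) \<in> measure rank \<and> sdim z = sdim x"
      if "regular_pair W x y" "z \<in> boundary K y - {x}" for x y z
      using regular_pairD(4,7)[OF that(1)] that(2) by (auto simp: boundary_def simplexes_def)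
  qed (auto simp: mem_cases critical_not_regular)
  then show ?thesis
    unfolding morse_reference_def is_morse_reference_def morse_frames_def critical_chains_def
    by (rule theI')
qed

lemma is_morse_coreference: "is_morse_coreference K W (morse_coreference K W)"
proof -
  have "\<exists>!f. f \<in> (\<Pi>\<^sub>E x\<in>K. Pow {c. critical W c \<and> sdim c = sdim x}) \<and>
      (\<forall>x. critical W x \<longrightarrow> f x = {x}) \<and>
      (\<forall>y x. regular_pair W x y \<longrightarrow> f x = {} \<and> f y = chain_sum f (coboundary K x - {y}))"
  \<comment> \<open>The co-reference recurses towards larger ranks, so the measure reverses
    \<open>rank\<close>.\<close>
  proof (rule ex1_frame[OF wf_measure[of "\<lambda>x. length W - rank x"]])
    show "\<not> regular_pair W y z" if "regular_pair W x y" for x y z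
      using regular_pair_unique(1)[OF that, of y z] regular_pairD(3)[OF that] by blast
    show "x = z" if "regular_pair W x y" "regular_pair W z y" for x y z
      using regular_pair_unique(1)[OF that] by blast
    show "z \<in> K \<and> (z, y) \<in> measure (\<lambda>x. length W - rank x) \<and> sdim z = sdim y"
      if "regular_pair W x y" "z \<in> coboundary K x - {y}" for x y z
    proof -
      have "z \<in> K" "sdim z = sdim y"
        using regular_pairD(4)[OF that(1)] that(2) by (auto simp: coboundary_def simplexes_def)
      \<comment> \<open>Subtraction of naturals is truncated; this bound keeps the reversed
        inequality strict.\<close>
      moreover have "rank z < length W"
        using \<open>z \<in> K\<close> by (metis rank_of_mem)
      ultimately show ?thesis
        using regular_pairD(8)[OF that] by auto
    qed
  qed (auto simp: mem_cases critical_not_regular)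
  \<comment> \<open>The converse relation binds the upper simplex first; here the quantifiers are
    put back in order.\<close>
  moreover have "is_morse_coreference K W f \<longleftrightarrow>
      f \<in> (\<Pi>\<^sub>E x\<in>K. Pow {c. critical W c \<and> sdim c = sdim x}) \<and>
      (\<forall>x. critical W x \<longrightarrow> f x = {x}) \<and>
      (\<forall>y x. regular_pair W x y \<longrightarrow> f x = {} \<and> f y = chain_sum f (coboundary K x - {y}))" for f
    unfolding is_morse_coreference_def morse_frames_def critical_chains_def
    by (intro conj_cong refl all_comm)
  ultimately have "\<exists>!f. is_morse_coreference K W f"
    by simp
  then show ?thesis
    unfolding morse_coreference_def by (rule theI')
qed

end

section \<open>Duality\<close>

theorem theorem1:
  fixes K :: "'a set set" and W :: "'a set set list" and \<sigma> \<tau> :: "'a set" and p :: int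
  assumes "simplicial_complex K"
    and "morse_sequence K W"
    and "\<sigma> \<in> simplexes K p"
    and "\<tau> \<in> simplexes K (p + 1)"
    and "critical W \<sigma>"
    and "critical W \<tau>"
  shows "\<sigma> \<in> chain_sum (morse_reference K W) (boundary K \<tau>) \<longleftrightarrow>
         \<tau> \<in> chain_sum (morse_coreference K W) (coboundary K \<sigma>)"
proof -
  define f where "f = morse_reference K W"
  define g where "g = morse_coreference K W"
  have f: "\<And>x. critical W x \<Longrightarrow> f x = {x}" "\<And>x y. regular_pair W x y \<Longrightarrow> f y = {}"
    "\<And>x y. regular_pair W x y \<Longrightarrow> f x = chain_sum f (boundary K y - {x})"
    using is_morse_reference[OF assms(2)] unfolding f_def is_morse_reference_def by blast+
  have g: "\<And>x. critical W x \<Longrightarrow> g x = {x}" "\<And>x y. regular_pair W x y \<Longrightarrow> g x = {}"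
    "\<And>x y. regular_pair W x y \<Longrightarrow> g y = chain_sum g (coboundary K x - {y})"
    using is_morse_coreference[OF assms(2)] unfolding g_def is_morse_coreference_def by blast+
  have fin: "finite K" "finite (simplexes K q)" "finite (boundary K x)" "finite (coboundary K x)"
    for q x
    using assms(1) by (auto simp: simplicial_complex_def simplexes_def boundary_def coboundary_def)
  define A where "A = {x \<in> simplexes K p. \<sigma> \<in> f x}"
  define B where "B = {y \<in> simplexes K (p + 1). \<tau> \<in> g y}"
  have finAB: "finite A" "finite B"
    using fin unfolding A_def B_def by auto
  have bd: "\<sigma> \<in> chain_sum f (boundary K y) \<longleftrightarrow> odd (card {x \<in> A. x \<subset> y})"
    if "y \<in> simplexes K (p + 1)" for y
  proof -
    have "{x \<in> boundary K y. \<sigma> \<in> f x} = {x \<in> A. x \<subset> y}"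
      using that by (auto simp: A_def boundary_def simplexes_def)
    then show ?thesis by (simp add: mem_chain_sum_iff fin)
  qed
  have cobd: "\<tau> \<in> chain_sum g (coboundary K x) \<longleftrightarrow> odd (card {y \<in> B. x \<subset> y})"
    if "x \<in> simplexes K p" for x
  proof -
    have "{y \<in> coboundary K x. \<tau> \<in> g y} = {y \<in> B. x \<subset> y}"
      using that by (auto simp: B_def coboundary_def simplexes_def)
    then show ?thesis by (simp add: mem_chain_sum_iff fin)
  qed
  have "\<sigma> \<notin> chain_sum f (boundary K y)" if "y \<in> B" "y \<noteq> \<tau>" for y
  proof -
    have "y \<in> K" "\<tau> \<in> g y" using that by (auto simp: B_def simplexes_def)
    \<comment> \<open>If \<open>y\<close> were critical, \<open>g y = {y}\<close> would miss
      \<open>\<tau>\<close>; if it were the lower member of a pair, \<open>g y\<close> would be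
      empty.\<close>
    then obtain x where xy: "regular_pair W x y"
      using mem_cases[OF assms(2), of y] g(1,2) \<open>y \<noteq> \<tau>\<close> by auto
    then have "x \<in> boundary K y"
      using regular_pairD(1,3,4)[OF assms(2) xy] by (simp add: boundary_def simplexes_def)
    then show ?thesis
      using chain_sum_eq_empty[OF fin(3), of x y f] f(3)[OF xy] by simp
  qed
  \<comment> \<open>Only \<open>\<tau>\<close> can contribute, and it does lie in \<open>B\<close>
    because \<open>g \<tau> = {\<tau>}\<close>.\<close>
  then have "{y \<in> B. odd (card {x \<in> A. x \<subset> y})} =
      (if \<sigma> \<in> chain_sum f (boundary K \<tau>) then {\<tau>} else {})"
    using bd assms(4) g(1)[OF assms(6)] by (auto simp: B_def)
  then have *: "odd (card {y \<in> B. odd (card {x \<in> A. x \<subset> y})}) \<longleftrightarrow>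
      \<sigma> \<in> chain_sum f (boundary K \<tau>)"
    by simp
  \<comment> \<open>Dually, \<open>x\<close> must be the lower member of a pair, and
    \<open>g\<close> vanishes on its coboundary.\<close>
  have "\<tau> \<notin> chain_sum g (coboundary K x)" if "x \<in> A" "x \<noteq> \<sigma>" for x
  proof -
    have "x \<in> K" "\<sigma> \<in> f x" using that by (auto simp: A_def simplexes_def)
    then obtain y where xy: "regular_pair W x y"
      using mem_cases[OF assms(2), of x] f(1,2) \<open>x \<noteq> \<sigma>\<close> by auto
    then have "y \<in> coboundary K x"
      using regular_pairD(2,3,4)[OF assms(2) xy] by (simp add: coboundary_def simplexes_def)
    then show ?thesis
      using chain_sum_eq_empty[OF fin(4), of y x g] g(3)[OF xy] by simp
  qed
  then have "{x \<in> A. odd (card {y \<in> B. x \<subset> y})} =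
      (if \<tau> \<in> chain_sum g (coboundary K \<sigma>) then {\<sigma>} else {})"
    using cobd assms(3) f(1)[OF assms(5)] by (auto simp: A_def)
  then have "odd (card {x \<in> A. odd (card {y \<in> B. x \<subset> y})}) \<longleftrightarrow>
      \<tau> \<in> chain_sum g (coboundary K \<sigma>)"
    by simp
  with * odd_card_odd_swap[OF finAB, of "(\<subset>)"] show ?thesis
    unfolding f_def g_def by simp
qed

end
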